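(* Let $u<v$ be real numbers and let $f\colon[u,v]_{\mathbb{Q}}\to\mathbb{R}$ be a function such that its derivative $f'$ is defined on all of $[u,v]_{\mathbb{Q}}$, is uniform and is uniformly continuous on $[u,v]_{\mathbb{Q}}$, and such that the extended values satisfy $f(u)=f(v)$. Then there exists a real number $x$ with $u<x<v$ and (extended value) $f'(x)=0$.
   Context: For reals $u\le v$, $[u,v]_{\mathbb{Q}}=\{a\in\mathbb{Q}\mid u\le a\le v\}$. For $M\subset\mathbb{Q}$, $g\colon M\to\mathbb{R}$ is uniformly continuous (UC) if for every $k\in\mathbb{N}$ there is $l\in\mathbb{N}$ with $a,b\in M$, $|a-b|\le 1/l\Rightarrow |g(a)-g(b)|\le 1/k$. If $g$ is UC and the real $x$ is a limit of elements of $M$, then $\lim g(a_n)$ exists for every sequence $(a_n)$ in $M$ converging to $x$ and is independent of the sequence; it is denoted $g(x)$ (extended value). (Under the hypotheses $f$ itself is UC, so $f(u),f(v)$ are defined.) For $f\colon M\to\mathbb{R}$ and $a\in M$ a limit point of $M$, $f'(a)=y$ if for every $k$ there is $l$ with $b\in M$, $0<|a-b|\le 1/l\Rightarrow|\frac{f(b)-f(a)}{b-a}-y|\le1/k$. The derivative is uniform on a set $N$ of points where it exists if for every $k$ there is $l$ such that for all $a\in N$, $b\in M$ with $0<|a-b|\le 1/l$: $|\frac{f(b)-f(a)}{b-a}-f'(a)|\le 1/k$. *)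

theory Defs
  imports "HOL-Analysis.Analysis"
begin

text \<open>
  A function on a set \<open>M\<close> of rationals is a function \<open>rat \<Rightarrow> real\<close>
  of which only the values on \<open>M\<close> are used. The type \<open>rat\<close> carries no metric or topology
  in the library, so the notions below are written out. Since \<open>1 / 0 = 0\<close>, the natural numbers
  \<open>k\<close> and \<open>l\<close> in moduli \<open>1/k\<close>, \<open>1/l\<close> are required to be positive.
\<close>

definition rat_Icc :: "real \<Rightarrow> real \<Rightarrow> rat set" where
  "rat_Icc u v = {a. u \<le> of_rat a \<and> of_rat a \<le> v}"

definition rat_UC :: "rat set \<Rightarrow> (rat \<Rightarrow> real) \<Rightarrow> bool" where
  "rat_UC M g \<longleftrightarrow>
     (\<forall>k::nat. k > 0 \<longrightarrow> (\<exists>l::nat. l > 0 \<and>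
        (\<forall>a\<in>M. \<forall>b\<in>M. \<bar>a - b\<bar> \<le> 1 / of_nat l \<longrightarrow> \<bar>g a - g b\<bar> \<le> 1 / of_nat k)))"

text \<open>
  The extended value \<open>g(x)\<close>. It is meaningful when \<open>g\<close> is uniformly continuous on \<open>M\<close> and
  \<open>x\<close> is a limit of a sequence in \<open>M\<close>; see \<open>ext_value_LIMSEQ\<close> below.
\<close>

definition ext_value :: "rat set \<Rightarrow> (rat \<Rightarrow> real) \<Rightarrow> real \<Rightarrow> real" where
  "ext_value M g x =
     (THE y. \<forall>s::nat \<Rightarrow> rat. (\<forall>n. s n \<in> M) \<longrightarrow> (\<lambda>n. real_of_rat (s n)) \<longlonglongrightarrow> x
        \<longrightarrow> (\<lambda>n. g (s n)) \<longlonglongrightarrow> y)"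

definition has_rat_deriv :: "rat set \<Rightarrow> (rat \<Rightarrow> real) \<Rightarrow> rat \<Rightarrow> real \<Rightarrow> bool" where
  "has_rat_deriv M f a y \<longleftrightarrow>
     a \<in> M \<and> real_of_rat a islimpt (real_of_rat ` M) \<and>
     (\<forall>k::nat. k > 0 \<longrightarrow> (\<exists>l::nat. l > 0 \<and>
        (\<forall>b\<in>M. 0 < \<bar>a - b\<bar> \<and> \<bar>a - b\<bar> \<le> 1 / of_nat l
           \<longrightarrow> \<bar>(f b - f a) / real_of_rat (b - a) - y\<bar> \<le> 1 / of_nat k)))"

definition rat_deriv_uniform_on ::
    "rat set \<Rightarrow> rat set \<Rightarrow> (rat \<Rightarrow> real) \<Rightarrow> (rat \<Rightarrow> real) \<Rightarrow> bool" where
  "rat_deriv_uniform_on N M f f' \<longleftrightarrow>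
     (\<forall>k::nat. k > 0 \<longrightarrow> (\<exists>l::nat. l > 0 \<and>
        (\<forall>a\<in>N. \<forall>b\<in>M. 0 < \<bar>a - b\<bar> \<and> \<bar>a - b\<bar> \<le> 1 / of_nat l
           \<longrightarrow> \<bar>(f b - f a) / real_of_rat (b - a) - f' a\<bar> \<le> 1 / of_nat k)))"

lemma rat_UC_close:
  assumes UC: "rat_UC M g" and e: "0 < e"
  obtains d :: real where "0 < d"
    "\<And>a b. a \<in> M \<Longrightarrow> b \<in> M \<Longrightarrow> \<bar>real_of_rat a - real_of_rat b\<bar> < d \<Longrightarrow> \<bar>g a - g b\<bar> < e"
proof -
  obtain k where k: "inverse (real (Suc k)) < e"
    using reals_Archimedean[OF e] by auto
  obtain l :: nat where l: "l > 0"
    "\<And>a b. a \<in> M \<Longrightarrow> b \<in> M \<Longrightarrow> \<bar>a - b\<bar> \<le> 1 / of_nat l \<Longrightarrow> \<bar>g a - g b\<bar> \<le> 1 / of_nat (Suc k)"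
    using UC unfolding rat_UC_def by (metis zero_less_Suc)
  show thesis
  proof (rule that[of "1 / real l"])
    show "0 < 1 / real l" using l(1) by simp
    fix a b assume ab: "a \<in> M" "b \<in> M" "\<bar>real_of_rat a - real_of_rat b\<bar> < 1 / real l"
    have "real_of_rat \<bar>a - b\<bar> \<le> real_of_rat (1 / of_nat l)"
      using ab(3) by (simp add: of_rat_diff of_rat_divide flip: abs_of_rat)
    then have "\<bar>a - b\<bar> \<le> 1 / of_nat l" by (simp only: of_rat_less_eq)
    from l(2)[OF ab(1,2) this] k show "\<bar>g a - g b\<bar> < e"
      by (simp add: inverse_eq_divide)
  qed
qed

lemma ext_value_LIMSEQ:
  assumes UC: "rat_UC M g"
    and s: "\<And>n. s n \<in> M" "(\<lambda>n. real_of_rat (s n)) \<longlonglongrightarrow> x"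
  shows "(\<lambda>n. g (s n)) \<longlonglongrightarrow> ext_value M g x"
proof -
  have "Cauchy (\<lambda>n. g (s n))"
  proof (rule metric_CauchyI)
    fix e :: real assume "0 < e"
    then obtain d where d: "0 < d"
      "\<And>a b. a \<in> M \<Longrightarrow> b \<in> M \<Longrightarrow> \<bar>real_of_rat a - real_of_rat b\<bar> < d \<Longrightarrow> \<bar>g a - g b\<bar> < e"
      using rat_UC_close[OF UC] by metis
    have "Cauchy (\<lambda>n. real_of_rat (s n))"
      using s(2) by (rule LIMSEQ_imp_Cauchy)
    from metric_CauchyD[OF this d(1)]
    show "\<exists>N. \<forall>m\<ge>N. \<forall>n\<ge>N. dist (g (s m)) (g (s n)) < e"
      using d(2) s(1) unfolding dist_real_def by meson
  qed
  then obtain y where y: "(\<lambda>n. g (s n)) \<longlonglongrightarrow> y"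
    using Cauchy_convergent convergent_def by blast
  have lim: "(\<lambda>n. g (t n)) \<longlonglongrightarrow> y"
    if t: "\<forall>n. t n \<in> M" "(\<lambda>n. real_of_rat (t n)) \<longlonglongrightarrow> x" for t
  proof -
    have "(\<lambda>n. g (t n) - g (s n)) \<longlonglongrightarrow> 0"
    proof (rule tendstoI)
      fix e :: real assume "0 < e"
      then obtain d where d: "0 < d"
        "\<And>a b. a \<in> M \<Longrightarrow> b \<in> M \<Longrightarrow> \<bar>real_of_rat a - real_of_rat b\<bar> < d \<Longrightarrow> \<bar>g a - g b\<bar> < e"
        using rat_UC_close[OF UC] by metis
      have "(\<lambda>n. real_of_rat (t n) - real_of_rat (s n)) \<longlonglongrightarrow> 0"
        using tendsto_diff[OF t(2) s(2)] by simp
      from tendstoD[OF this d(1)]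
      show "\<forall>\<^sub>F n in sequentially. dist (g (t n) - g (s n)) 0 < e"
        by eventually_elim (use d(2) s(1) t(1) in \<open>auto simp: dist_real_def\<close>)
    qed
    from tendsto_add[OF this y] show ?thesis by simp
  qed
  have "ext_value M g x = y"
    unfolding ext_value_def
  proof (rule the_equality)
    show "\<forall>t. (\<forall>n. t n \<in> M) \<longrightarrow> (\<lambda>n. real_of_rat (t n)) \<longlonglongrightarrow> x \<longrightarrow> (\<lambda>n. g (t n)) \<longlonglongrightarrow> y"
      using lim by blast
    fix z
    assume "\<forall>t. (\<forall>n. t n \<in> M) \<longrightarrow> (\<lambda>n. real_of_rat (t n)) \<longlonglongrightarrow> x \<longrightarrow> (\<lambda>n. g (t n)) \<longlonglongrightarrow> z"
    with s have "(\<lambda>n. g (s n)) \<longlonglongrightarrow> z" by blast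
    with y show "z = y" using LIMSEQ_unique by blast
  qed
  with y show ?thesis by simp
qed

end

theory Submission imports Defs begin

text \<open>
  Both \<open>f\<close> and \<open>f'\<close> extend continuously to the real interval: \<open>f'\<close> is uniformly continuous by
  assumption, hence bounded, and a uniform bounded derivative makes \<open>f\<close> Lipschitz at small scales.
  The uniform estimate \<open>\<bar>f b - f a - f' a * (b - a)\<bar> \<le> e * \<bar>b - a\<bar>\<close> survives passage
  to the limit in \<open>a\<close> and \<open>b\<close>, so the extension of \<open>f'\<close> is the derivative of the
  extension of \<open>f\<close>, and Rolle's theorem applies.
\<close>

text \<open>Counterpart of \<open>rat_UC_close\<close>: it allows uniform continuity to be
  established with a real \<epsilon> and \<delta> instead of the moduli \<open>1/k\<close> and
  \<open>1/l\<close>.\<close>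

lemma rat_UC_I:
  assumes "\<And>e. 0 < e \<Longrightarrow> \<exists>d>0. \<forall>a\<in>M. \<forall>b\<in>M.
      \<bar>real_of_rat a - real_of_rat b\<bar> < d \<longrightarrow> \<bar>g a - g b\<bar> \<le> e"
  shows "rat_UC M g"
  unfolding rat_UC_def
proof (intro allI impI)
  fix k :: nat assume "k > 0"
  then obtain d where d: "0 < d" "\<And>a b. a \<in> M \<Longrightarrow> b \<in> M \<Longrightarrow>
      \<bar>real_of_rat a - real_of_rat b\<bar> < d \<Longrightarrow> \<bar>g a - g b\<bar> \<le> 1 / real k"
    using assms[of "1 / real k"] by auto
  obtain n where n: "inverse (real (Suc n)) < d"
    using reals_Archimedean[OF d(1)] by auto
  \<comment> \<open>\<open>Suc n\<close> is a positive modulus, and \<open>1 / Suc n < d\<close>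
    turns the non-strict closeness of \<open>a\<close> and \<open>b\<close> into the strict one that
    \<open>d\<close> asks for.\<close>
  show "\<exists>l>0. \<forall>a\<in>M. \<forall>b\<in>M. \<bar>a - b\<bar> \<le> 1 / of_nat l \<longrightarrow> \<bar>g a - g b\<bar> \<le> 1 / real k"
  proof (intro exI[of _ "Suc n"] conjI ballI impI)
    fix a b assume ab: "a \<in> M" "b \<in> M" "\<bar>a - b\<bar> \<le> 1 / of_nat (Suc n)"
    from ab(3) have "real_of_rat \<bar>a - b\<bar> \<le> real_of_rat (1 / of_nat (Suc n))"
      by (simp only: of_rat_less_eq)
    then have "\<bar>real_of_rat a - real_of_rat b\<bar> \<le> 1 / real (Suc n)"
      by (simp only: of_rat_diff of_rat_divide of_rat_of_nat_eq of_rat_1 flip: abs_of_rat)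
    then have "\<bar>real_of_rat a - real_of_rat b\<bar> < d"
      using n by (simp add: inverse_eq_divide)
    then show "\<bar>g a - g b\<bar> \<le> 1 / real k" using d(2) ab by blast
  qed simp
qed

text \<open>Clearing the denominator of the difference quotient admits \<open>a = b\<close> and
  leaves an inequality between expressions that converge when \<open>a\<close> and \<open>b\<close>
  do. This is the form that survives the passage to real points.\<close>

lemma rat_deriv_uniform_on_linear_bound:
  assumes U: "rat_deriv_uniform_on N M f f'" and e: "0 < e"
  obtains d :: real where "0 < d"
    "\<And>a b. a \<in> N \<Longrightarrow> b \<in> M \<Longrightarrow> \<bar>real_of_rat a - real_of_rat b\<bar> < d \<Longrightarrow>
       \<bar>f b - f a - f' a * (real_of_rat b - real_of_rat a)\<bar> \<le> e * \<bar>real_of_rat b - real_of_rat a\<bar>"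
proof -
  obtain k where k: "inverse (real (Suc k)) < e"
    using reals_Archimedean[OF e] by auto
  obtain l :: nat where l: "l > 0"
    "\<And>a b. a \<in> N \<Longrightarrow> b \<in> M \<Longrightarrow> 0 < \<bar>a - b\<bar> \<Longrightarrow> \<bar>a - b\<bar> \<le> 1 / of_nat l \<Longrightarrow>
       \<bar>(f b - f a) / real_of_rat (b - a) - f' a\<bar> \<le> 1 / of_nat (Suc k)"
    using U unfolding rat_deriv_uniform_on_def by (metis zero_less_Suc)
  show thesis
  proof (rule that[of "1 / real l"])
    show "0 < 1 / real l" using l(1) by simp
    fix a b assume ab: "a \<in> N" "b \<in> M" "\<bar>real_of_rat a - real_of_rat b\<bar> < 1 / real l"
    define h where "h = real_of_rat b - real_of_rat a"
    show "\<bar>f b - f a - f' a * (real_of_rat b - real_of_rat a)\<bar> \<le> e * \<bar>real_of_rat b - real_of_rat a\<bar>"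
    proof (cases "a = b")
      case False
      then have h: "h \<noteq> 0" by (simp add: h_def)
      have "real_of_rat \<bar>a - b\<bar> \<le> real_of_rat (1 / of_nat l)"
        using ab(3) by (simp add: of_rat_diff of_rat_divide flip: abs_of_rat)
      then have "\<bar>a - b\<bar> \<le> 1 / of_nat l" by (simp only: of_rat_less_eq)
      with l(2)[OF ab(1,2)] False have "\<bar>(f b - f a) / h - f' a\<bar> \<le> 1 / of_nat (Suc k)"
        by (simp add: h_def of_rat_diff)
      also have "\<dots> \<le> e" using k by (simp add: inverse_eq_divide)
      finally have "\<bar>(f b - f a) / h - f' a\<bar> * \<bar>h\<bar> \<le> e * \<bar>h\<bar>"
        by (rule mult_right_mono) simp
      moreover have "((f b - f a) / h - f' a) * h = f b - f a - f' a * h"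
        using h by (simp add: field_simps)
      ultimately show ?thesis by (simp add: h_def flip: abs_mult)
    qed simp
  qed
qed

lemma rat_seq_of_closure:
  assumes "x \<in> closure (real_of_rat ` M)"
  obtains s where "\<And>n. s n \<in> M" "(\<lambda>n. real_of_rat (s n)) \<longlonglongrightarrow> x"
proof -
  obtain r where r: "\<And>n. r n \<in> real_of_rat ` M" "r \<longlonglongrightarrow> x"
    using assms unfolding closure_sequential by blast
  then obtain s where "\<And>n. s n \<in> M \<and> r n = real_of_rat (s n)"
    unfolding image_iff by metis
  then have "r = (\<lambda>n. real_of_rat (s n))" "\<And>n. s n \<in> M" by auto
  with r(2) that show thesis by blast
qed

text \<open>The constant sequence at \<open>a\<close> is one of the sequences that compute the
  extended value.\<close>

lemma ext_value_of_rat: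
  assumes "rat_UC M g" "a \<in> M"
  shows "ext_value M g (real_of_rat a) = g a"
  using ext_value_LIMSEQ[OF assms(1), of "\<lambda>_. a"] assms(2)
  by (simp add: LIMSEQ_const_iff)

text \<open>A modulus of uniform continuity of \<open>g\<close> carries over to the extension, by
  approximating both real points by rationals of \<open>M\<close>.\<close>

lemma continuous_on_ext_value:
  assumes UC: "rat_UC M g"
  shows "continuous_on (closure (real_of_rat ` M)) (ext_value M g)"
  unfolding continuous_on_iff
proof (intro ballI allI impI)
  fix x and e :: real assume x: "x \<in> closure (real_of_rat ` M)" and "0 < e"
  \<comment> \<open>Only a non-strict bound survives the limit, so \<open>e / 2\<close> is used to
    end strictly below \<open>e\<close>.\<close>
  then obtain d where d: "0 < d" "\<And>a b. a \<in> M \<Longrightarrow> b \<in> M \<Longrightarrow>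
      \<bar>real_of_rat a - real_of_rat b\<bar> < d \<Longrightarrow> \<bar>g a - g b\<bar> < e / 2"
    using rat_UC_close[OF UC, of "e / 2"] by (metis half_gt_zero)
  have "dist (ext_value M g y) (ext_value M g x) < e"
    if y: "y \<in> closure (real_of_rat ` M)" "dist y x < d" for y
  proof -
    obtain s where s: "\<And>n. s n \<in> M" "(\<lambda>n. real_of_rat (s n)) \<longlonglongrightarrow> x"
      using rat_seq_of_closure[OF x] by blast
    obtain t where t: "\<And>n. t n \<in> M" "(\<lambda>n. real_of_rat (t n)) \<longlonglongrightarrow> y"
      using rat_seq_of_closure[OF y(1)] by blast
    have "(\<lambda>n. \<bar>real_of_rat (t n) - real_of_rat (s n)\<bar>) \<longlonglongrightarrow> \<bar>y - x\<bar>"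
      by (intro tendsto_intros s t)
    \<comment> \<open>The limit of the distances is strictly below \<open>d\<close>, hence so are
      the distances from some index on.\<close>
    from order_tendstoD(2)[OF this, of d] y(2)
    have ev: "\<forall>\<^sub>F n in sequentially. \<bar>real_of_rat (t n) - real_of_rat (s n)\<bar> < d"
      by (simp add: dist_real_def)
    have "\<bar>ext_value M g y - ext_value M g x\<bar> \<le> e / 2"
    proof (rule tendsto_upperbound)
      show "(\<lambda>n. \<bar>g (t n) - g (s n)\<bar>) \<longlonglongrightarrow> \<bar>ext_value M g y - ext_value M g x\<bar>"
        by (intro tendsto_intros ext_value_LIMSEQ[OF UC] s t)
      show "\<forall>\<^sub>F n in sequentially. \<bar>g (t n) - g (s n)\<bar> \<le> e / 2"
        using ev by eventually_elim (use d(2) s(1) t(1) less_imp_le in blast)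
    qed simp
    with \<open>0 < e\<close> show ?thesis by (simp add: dist_real_def)
  qed
  with d(1) show "\<exists>d>0. \<forall>y\<in>closure (real_of_rat ` M).
      dist y x < d \<longrightarrow> dist (ext_value M g y) (ext_value M g x) < e"
    by blast
qed

text \<open>The closure of a bounded set of reals is compact, so the continuous extension of
  \<open>g\<close> is bounded there, and it agrees with \<open>g\<close> on
  \<open>M\<close>.\<close>

lemma rat_UC_imp_bounded:
  assumes UC: "rat_UC M g" and M: "bounded (real_of_rat ` M)"
  shows "bounded (g ` M)"
proof -
  have "compact (ext_value M g ` closure (real_of_rat ` M))"
    using M by (intro compact_continuous_image continuous_on_ext_value UC) simp
  then have "bounded (ext_value M g ` closure (real_of_rat ` M))"
    by (rule compact_imp_bounded)
  moreover have "g ` M \<subseteq> ext_value M g ` closure (real_of_rat ` M)"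
  proof
    fix y assume "y \<in> g ` M"
    then obtain a where "a \<in> M" "y = ext_value M g (real_of_rat a)"
      using ext_value_of_rat[OF UC] by auto
    then show "y \<in> ext_value M g ` closure (real_of_rat ` M)"
      using closure_subset by blast
  qed
  ultimately show ?thesis by (rule bounded_subset)
qed

text \<open>If \<open>B\<close> bounds \<open>f'\<close>, the linear bound with error constant 1
  gives the Lipschitz constant \<open>B + 1\<close> for pairs of points that are close
  enough.\<close>

lemma rat_UC_of_uniform_bounded_deriv:
  assumes U: "rat_deriv_uniform_on M M f f'" and B: "bounded (f' ` M)"
  shows "rat_UC M f"
proof (rule rat_UC_I)
  fix e :: real assume e: "0 < e"
  obtain B where B: "0 < B" "\<And>a. a \<in> M \<Longrightarrow> \<bar>f' a\<bar> \<le> B"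
    using B unfolding bounded_pos by auto
  obtain d where d: "0 < d" "\<And>a b. a \<in> M \<Longrightarrow> b \<in> M \<Longrightarrow> \<bar>real_of_rat a - real_of_rat b\<bar> < d \<Longrightarrow>
      \<bar>f b - f a - f' a * (real_of_rat b - real_of_rat a)\<bar> \<le> 1 * \<bar>real_of_rat b - real_of_rat a\<bar>"
    using rat_deriv_uniform_on_linear_bound[OF U zero_less_one] by blast
  show "\<exists>d>0. \<forall>a\<in>M. \<forall>b\<in>M. \<bar>real_of_rat a - real_of_rat b\<bar> < d \<longrightarrow> \<bar>f a - f b\<bar> \<le> e"
  \<comment> \<open>Below \<open>d\<close> the Lipschitz estimate is valid; below
    \<open>e / (B + 1)\<close> it yields at most \<open>e\<close>.\<close>
  proof (intro exI[of _ "min d (e / (B + 1))"] conjI ballI impI)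
    show "0 < min d (e / (B + 1))" using d(1) e B(1) by simp
    fix a b assume ab: "a \<in> M" "b \<in> M"
      "\<bar>real_of_rat a - real_of_rat b\<bar> < min d (e / (B + 1))"
    define h where "h = real_of_rat b - real_of_rat a"
    have h: "\<bar>h\<bar> < e / (B + 1)" and "\<bar>f b - f a - f' a * h\<bar> \<le> \<bar>h\<bar>"
      using ab d(2)[of a b] by (auto simp: h_def)
    moreover have "\<bar>f' a * h\<bar> \<le> B * \<bar>h\<bar>"
      unfolding abs_mult using B(2)[OF ab(1)] by (rule mult_right_mono) simp
    ultimately have "\<bar>f a - f b\<bar> \<le> (B + 1) * \<bar>h\<bar>"
      by (simp add: distrib_right)
    also have "\<dots> \<le> e" using h B(1) by (simp add: field_simps)
    finally show "\<bar>f a - f b\<bar> \<le> e" .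
  qed
qed

text \<open>The base point \<open>x\<close> may be irrational, so it too is approximated, by
  \<open>s n\<close>. Uniformity provides one \<open>d\<close> for all base points
  \<open>s n\<close>, and uniform continuity of \<open>f'\<close> makes the slopes
  \<open>f' (s n)\<close> converge.\<close>

lemma ext_value_has_field_derivative:
  assumes U: "rat_deriv_uniform_on M M f f'"
    and UC: "rat_UC M f" "rat_UC M f'"
    and x: "x \<in> closure (real_of_rat ` M)"
  shows "(ext_value M f has_field_derivative ext_value M f' x)
           (at x within closure (real_of_rat ` M))"
  unfolding has_field_derivative_def has_derivative_within_alt
proof (intro conjI allI impI)
  show "bounded_linear ((*) (ext_value M f' x))" by (rule bounded_linear_mult_right)
  fix e :: real assume "0 < e"
  then obtain d where d: "0 < d" "\<And>a b. a \<in> M \<Longrightarrow> b \<in> M \<Longrightarrow>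
      \<bar>real_of_rat a - real_of_rat b\<bar> < d \<Longrightarrow>
      \<bar>f b - f a - f' a * (real_of_rat b - real_of_rat a)\<bar> \<le> e * \<bar>real_of_rat b - real_of_rat a\<bar>"
    using rat_deriv_uniform_on_linear_bound[OF U] by blast
  have "norm (ext_value M f y - ext_value M f x - ext_value M f' x * (y - x)) \<le> e * norm (y - x)"
    if y: "y \<in> closure (real_of_rat ` M)" "norm (y - x) < d" for y
  proof -
    obtain s where s: "\<And>n. s n \<in> M" "(\<lambda>n. real_of_rat (s n)) \<longlonglongrightarrow> x"
      using rat_seq_of_closure[OF x] by blast
    obtain t where t: "\<And>n. t n \<in> M" "(\<lambda>n. real_of_rat (t n)) \<longlonglongrightarrow> y"
      using rat_seq_of_closure[OF y(1)] by blast
    have "(\<lambda>n. \<bar>real_of_rat (s n) - real_of_rat (t n)\<bar>) \<longlonglongrightarrow> \<bar>x - y\<bar>"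
      by (intro tendsto_intros s t)
    from order_tendstoD(2)[OF this, of d] y(2)
    have ev: "\<forall>\<^sub>F n in sequentially. \<bar>real_of_rat (s n) - real_of_rat (t n)\<bar> < d"
      by (simp add: abs_minus_commute)
    have "\<bar>ext_value M f y - ext_value M f x - ext_value M f' x * (y - x)\<bar> \<le> e * \<bar>y - x\<bar>"
    \<comment> \<open>Both sides of the linear bound converge. The derivative criterion is itself
      non-strict, so here \<open>e\<close> need not be halved.\<close>
    proof (rule tendsto_le)
      show "(\<lambda>n. \<bar>f (t n) - f (s n) - f' (s n) * (real_of_rat (t n) - real_of_rat (s n))\<bar>)
          \<longlonglongrightarrow> \<bar>ext_value M f y - ext_value M f x - ext_value M f' x * (y - x)\<bar>"
        by (intro tendsto_intros ext_value_LIMSEQ[OF UC(1)] ext_value_LIMSEQ[OF UC(2)] s t)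
      show "(\<lambda>n. e * \<bar>real_of_rat (t n) - real_of_rat (s n)\<bar>) \<longlonglongrightarrow> e * \<bar>y - x\<bar>"
        by (intro tendsto_intros s t)
      show "\<forall>\<^sub>F n in sequentially.
          \<bar>f (t n) - f (s n) - f' (s n) * (real_of_rat (t n) - real_of_rat (s n))\<bar>
            \<le> e * \<bar>real_of_rat (t n) - real_of_rat (s n)\<bar>"
        using ev by eventually_elim (use d(2) s(1) t(1) in blast)
    qed simp
    then show ?thesis by simp
  qed
  with d(1) show "\<exists>d>0. \<forall>y\<in>closure (real_of_rat ` M). norm (y - x) < d \<longrightarrow>
      norm (ext_value M f y - ext_value M f x - ext_value M f' x * (y - x)) \<le> e * norm (y - x)"
    by blast
qed

lemma closure_rat_Icc:
  assumes "u < v"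
  shows "closure (real_of_rat ` rat_Icc u v) = {u..v}"
proof
  show "closure (real_of_rat ` rat_Icc u v) \<subseteq> {u..v}"
    by (rule closure_minimal) (auto simp: rat_Icc_def)
  show "{u..v} \<subseteq> closure (real_of_rat ` rat_Icc u v)"
  proof
    fix x assume x: "x \<in> {u..v}"
    have "\<exists>y\<in>real_of_rat ` rat_Icc u v. dist y x < e" if e: "0 < e" for e
    proof -
      \<comment> \<open>The intervals from \<open>u\<close> to \<open>v\<close> and from
        \<open>x - e\<close> to \<open>x + e\<close> overlap in a nonempty open interval even if
        \<open>x\<close> is an endpoint, because \<open>u < v\<close>.\<close>
      have "max u (x - e) < min v (x + e)" using x e assms by auto
      then obtain q where "max u (x - e) < real_of_rat q" "real_of_rat q < min v (x + e)"
        using of_rat_dense by blast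
      then show ?thesis by (intro bexI[of _ "real_of_rat q"]) (auto simp: rat_Icc_def dist_real_def)
    qed
    then show "x \<in> closure (real_of_rat ` rat_Icc u v)"
      by (simp add: closure_approachable)
  qed
qed

theorem theorem2p45:
  fixes u v :: real and f f' :: "rat \<Rightarrow> real"
  assumes "u < v"
    and "\<And>a. a \<in> rat_Icc u v \<Longrightarrow> has_rat_deriv (rat_Icc u v) f a (f' a)"
    and "rat_deriv_uniform_on (rat_Icc u v) (rat_Icc u v) f f'"
    and "rat_UC (rat_Icc u v) f'"
    and "ext_value (rat_Icc u v) f u = ext_value (rat_Icc u v) f v"
  shows "\<exists>x. u < x \<and> x < v \<and> ext_value (rat_Icc u v) f' x = 0"
proof -
  let ?M = "rat_Icc u v"
  note cl = closure_rat_Icc[OF \<open>u < v\<close>]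
  have "bounded (real_of_rat ` ?M)"
    by (rule bounded_subset[of "{u..v}"]) (auto simp: rat_Icc_def)
  then have UC: "rat_UC ?M f"
    using rat_UC_of_uniform_bounded_deriv rat_UC_imp_bounded assms(3,4) by blast
  \<comment> \<open>At interior points the derivative within the closed interval is the two-sided
    one that Rolle's theorem expects.\<close>
  have "(ext_value ?M f has_derivative (*) (ext_value ?M f' x)) (at x)" if "u < x" "x < v" for x
    using ext_value_has_field_derivative[OF assms(3) UC assms(4), of x] that
    by (simp add: cl has_field_derivative_def at_within_Icc_at)
  from Rolle_deriv[OF \<open>u < v\<close> assms(5) _ this] continuous_on_ext_value[OF UC]
  obtain z where z: "u < z" "z < v" "(*) (ext_value ?M f' z) = (\<lambda>h. 0)"
    unfolding cl by blast
  \<comment> \<open>Rolle's theorem yields a vanishing linear map; its value at 1 is the extended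
    value of \<open>f'\<close> at \<open>z\<close>.\<close>
  from fun_cong[OF z(3), of 1] z(1,2) show ?thesis by auto
qed

end
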